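(* Let $G:\mathbb{Z}_{>0}\to\mathbb{Z}_{>0}$ be defined by $$G(n)=\begin{cases}5n+1 & \text{if } n=h(n),\\ h(n) & \text{if } n>h(n),\end{cases}\qquad h(n)=2^{v_2(n)}\,3^{v_3(n)}.$$ Then no trajectory of $G$ diverges: for every positive integer $n$, the sequence $n, G(n), G(G(n)),\dots$ eventually enters a cycle (i.e. is eventually periodic).
   Context: $v_p(n)$ denotes the exponent of the prime $p$ in the factorization of $n$; $h(n)$ is the largest divisor of $n$ whose only prime factors are $2$ and $3$. *)

theory Defs
  imports "HOL-Computational_Algebra.Primes"
begin

definition h :: "nat \<Rightarrow> nat" where
  "h n = 2 ^ multiplicity 2 n * 3 ^ multiplicity 3 n"

text \<open>
  The domain of \<open>G\<close> is the set of positive integers, where \<open>h n \<le> n\<close>; hence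
  the second branch is the case \<open>n > h n\<close> (see \<open>h_le\<close>). The value at \<open>0\<close> is irrelevant,
  because \<open>G\<close> maps positive numbers to positive numbers (see \<open>G_pos\<close>).
\<close>
definition G :: "nat \<Rightarrow> nat" where
  "G n = (if n = h n then 5 * n + 1 else h n)"

definition eventually_periodic :: "(nat \<Rightarrow> 'a) \<Rightarrow> bool" where
  "eventually_periodic x \<longleftrightarrow> (\<exists>N p. p > 0 \<and> (\<forall>k\<ge>N. x (k + p) = x k))"

lemma h_dvd: "h n dvd n"
proof -
  have "coprime (2 ^ multiplicity 2 n :: nat) (3 ^ multiplicity 3 n)"
    by simp
  then show ?thesis
    unfolding h_def by (intro divides_mult multiplicity_dvd)
qed

lemma h_le: "n > 0 \<Longrightarrow> h n \<le> n"
  by (rule dvd_imp_le[OF h_dvd])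

lemma G_pos: "G n > 0"
  by (simp add: G_def h_def)

end

theory Submission
  imports Defs
begin

text \<open>
  On numbers of the form \<open>2\<^sup>a 3\<^sup>b\<close> the map amounts to \<open>n \<mapsto> h (5 n + 1)\<close>, and after one
  such step only the number 1 and pure powers of 2 or 3 occur, alternately. If \<open>2\<^sup>a\<close> is followed
  by neither 1 nor 3, then \<open>9\<close> divides \<open>5 \<cdot> 2\<^sup>a + 1\<close>, which forces \<open>a \<equiv> 4\<close> modulo 6.
  If the trajectory goes from \<open>2\<^sup>a\<close> through a power of 3 to \<open>2\<^sup>d\<close>, then
  \<open>2\<^sup>d \<le> 5 (5 \<cdot> 2\<^sup>a + 1) + 1 < 2 ^ (a + 5)\<close>, so \<open>d \<le> a + 4\<close>. Unless \<open>2\<^sup>d\<close> is in turn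
  followed by 1 or 3, \<open>a\<close> and \<open>d\<close> agree modulo 6, whence \<open>d \<le> a\<close>, and one concludes by
  descent.
\<close>

lemma h_eqI:
  assumes "\<not> 2 dvd m" "\<not> 3 dvd m"
  shows "h (2 ^ a * 3 ^ b * m) = 2 ^ a * 3 ^ b"
proof -
  have "\<not> 2 dvd (3 ^ b * m)" "\<not> 3 dvd (2 ^ a * m)"
    using assms prime_dvd_power[of "2 :: nat" 3 b] prime_dvd_power[of "3 :: nat" 2 a]
    by (auto simp: prime_dvd_mult_iff)
  then have "multiplicity 2 (2 ^ a * (3 ^ b * m)) = a" "multiplicity 3 (3 ^ b * (2 ^ a * m)) = b"
    by (intro multiplicity_eqI; simp)+
  then show ?thesis
    by (simp add: h_def ac_simps)
qed

lemma h_smooth: "h (2 ^ a * 3 ^ b) = 2 ^ a * 3 ^ b"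
  using h_eqI[of 1 a b] by simp

text \<open>Periodicity travels backwards along a trajectory: the same period works, with the
  threshold raised by \<open>j\<close>.\<close>

lemma eventually_periodic_funpowD:
  assumes "eventually_periodic (\<lambda>k. (f ^^ k) ((f ^^ j) x))"
  shows "eventually_periodic (\<lambda>k. (f ^^ k) x)"
proof -
  obtain N p where "p > 0" and per: "\<And>k. k \<ge> N \<Longrightarrow> (f ^^ (k + p + j)) x = (f ^^ (k + j)) x"
    using assms by (auto simp: eventually_periodic_def funpow_add)
  have "(f ^^ (k + p)) x = (f ^^ k) x" if "k \<ge> N + j" for k
    using per[of "k - j"] that by simp
  with \<open>p > 0\<close> show ?thesis
    unfolding eventually_periodic_def by blast
qed

lemma eventually_periodic_funpow_fixpoint:
  assumes "(f ^^ p) x = x" "p > 0"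
  shows "eventually_periodic (\<lambda>k. (f ^^ k) x)"
  using assms by (auto simp: eventually_periodic_def funpow_add intro!: exI[of _ p])

abbreviation eventually_cyclic :: "nat \<Rightarrow> bool" where
  "eventually_cyclic n \<equiv> eventually_periodic (\<lambda>k. (G ^^ k) n)"

text \<open>One application of \<open>G\<close> suffices if \<open>h\<close> fixes
  \<open>5 * x + 1\<close>; otherwise a second one strips the remaining factors. Positivity of
  \<open>j\<close> is recorded so that it can contribute to a period.\<close>

lemma funpow_G_step:
  assumes "x = h x"
  obtains j where "j > 0" "(G ^^ j) x = h (5 * x + 1)"
proof (cases "5 * x + 1 = h (5 * x + 1)")
  case True
  with assms show ?thesis by (intro that[of 1]) (auto simp: G_def)
next
  case False
  with assms show ?thesis by (intro that[of 2]) (auto simp: G_def numeral_2_eq_2)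
qed

lemma eventually_cyclic_step:
  assumes "eventually_cyclic (h (5 * x + 1))" "x = h x"
  shows "eventually_cyclic x"
  using funpow_G_step[OF assms(2)] assms(1) eventually_periodic_funpowD by metis

lemma eventually_cyclic_1: "eventually_cyclic 1"
proof (rule eventually_periodic_funpow_fixpoint)
  \<comment> \<open>The cycle is 1, 6, 31, 1.\<close>
  have "h 1 = 1" "h 6 = 6" "h 31 = 1"
    using h_smooth[of 0 0] h_smooth[of 1 1] h_eqI[of 31 0 0] by simp_all
  then show "(G ^^ 3) 1 = 1" by (simp add: G_def numeral_3_eq_3)
qed simp

lemma eventually_cyclic_3: "eventually_cyclic 3"
proof -
  \<comment> \<open>The trajectory is 3, 16, 81, 406, 2, 11, 1; it is treated from its end
    backwards.\<close>
  have h: "h 2 = 2" "h 3 = 3" "h 11 = 1" "h 16 = 16" "h 81 = 81" "h 406 = 2"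
    using h_smooth[of 1 0] h_smooth[of 0 1] h_eqI[of 11 0 0] h_smooth[of 4 0] h_smooth[of 0 4]
      h_eqI[of 203 1 0] by simp_all
  have "eventually_cyclic 2"
    by (rule eventually_cyclic_step) (use h eventually_cyclic_1 in simp_all)
  then have "eventually_cyclic 81"
    by (intro eventually_cyclic_step[of 81]) (use h in simp_all)
  then have "eventually_cyclic 16"
    by (intro eventually_cyclic_step[of 16]) (use h in simp_all)
  then show ?thesis
    by (intro eventually_cyclic_step[of 3]) (use h in simp_all)
qed

lemma h_succ_power_2:
  assumes "a > 0"
  shows "h (5 * 2 ^ a + 1) = 3 ^ multiplicity 3 (5 * 2 ^ a + 1 :: nat)"
proof -
  have "\<not> 2 dvd (5 * 2 ^ a + 1 :: nat)" using assms by simp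
  then show ?thesis by (simp add: h_def not_dvd_imp_multiplicity_0)
qed

lemma h_succ_power_3:
  assumes "b > 0"
  shows "h (5 * 3 ^ b + 1) = 2 ^ multiplicity 2 (5 * 3 ^ b + 1 :: nat)"
proof -
  have "3 dvd (5 * 3 ^ b :: nat)" using assms by simp
  then have "\<not> 3 dvd (5 * 3 ^ b + 1 :: nat)" by presburger
  then show ?thesis by (simp add: h_def not_dvd_imp_multiplicity_0)
qed

text \<open>Since 64 is 1 modulo 9, only \<open>a mod 6\<close> matters. For exponents 0 to 5 the
  values are 6, 11, 21, 41, 81, 161, and 9 divides only 81.\<close>

lemma nine_dvd_imp_exponent_mod_6:
  assumes "9 dvd (5 * 2 ^ a + 1 :: nat)"
  shows "a mod 6 = 4"
proof -
  have "(2 ^ a :: nat) = 64 ^ (a div 6) * 2 ^ (a mod 6)"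
    using power_add[of "2 :: nat" "6 * (a div 6)" "a mod 6"] by (simp add: power_mult)
  moreover have "(64 ^ (a div 6) :: nat) mod 9 = 1"
    using power_mod[of "64 :: nat" 9 "a div 6"] by simp
  ultimately have "(2 ^ a :: nat) mod 9 = 2 ^ (a mod 6) mod 9"
    by (metis mod_mult_left_eq mult_1)
  moreover have "(5 * 2 ^ a + 1 :: nat) mod 9 = (5 * (2 ^ a mod 9) + 1) mod 9"
    by (metis mod_add_left_eq mod_mult_right_eq)
  ultimately have *: "(5 * (2 ^ (a mod 6) mod 9) + 1 :: nat) mod 9 = 0"
    using assms by simp
  have "a mod 6 \<in> {0, 1, 2, 3, 4, 5}" by auto
  with * show ?thesis by auto
qed

lemma eventually_cyclic_power_2_if_not_4_mod_6:
  assumes "a mod 6 \<noteq> 4"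
  shows "eventually_cyclic (2 ^ a)"
proof (cases "a = 0")
  case True
  then show ?thesis using eventually_cyclic_1 by simp
next
  case False
  define c where "c = multiplicity 3 (5 * 2 ^ a + 1 :: nat)"
  have "\<not> (3 ^ 2 :: nat) dvd 5 * 2 ^ a + 1"
    using nine_dvd_imp_exponent_mod_6 assms by auto
  then have "c < 2"
    unfolding c_def using multiplicity_dvd' not_less by blast
  then have "c = 0 \<or> c = 1" by auto
  then have "eventually_cyclic (3 ^ c)"
    using eventually_cyclic_1 eventually_cyclic_3 by auto
  then show ?thesis
    using h_succ_power_2[of a] False h_smooth[of a 0]
    by (intro eventually_cyclic_step[of "2 ^ a"]) (simp_all add: c_def)
qed

lemma eventually_cyclic_power_2: "eventually_cyclic (2 ^ a)"
proof (induction a rule: less_induct)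
  case (less a)
  show ?case
  proof (cases "a mod 6 = 4")
    case False
    then show ?thesis by (rule eventually_cyclic_power_2_if_not_4_mod_6)
  next
    case True
    then have "a > 0" by (intro gr0I) simp
    define c where "c = multiplicity 3 (5 * 2 ^ a + 1 :: nat)"
    define d where "d = multiplicity 2 (5 * 3 ^ c + 1 :: nat)"
    have smooth: "(2 ^ a :: nat) = h (2 ^ a)" "(3 ^ c :: nat) = h (3 ^ c)"
      using h_smooth[of a 0] h_smooth[of 0 c] by simp_all
    obtain i where i: "i > 0" "(G ^^ i) (2 ^ a) = 3 ^ c"
      using funpow_G_step[OF smooth(1)] h_succ_power_2[OF \<open>a > 0\<close>] by (metis c_def)
    show ?thesis
    \<comment> \<open>The next step yields a pure power of 2 only when 3 divides
      \<open>3 ^ c\<close>; for \<open>c = 0\<close> the trajectory has already reached 1.\<close>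
    proof (cases "c = 0")
      case True
      then show ?thesis
        using i eventually_cyclic_1 eventually_periodic_funpowD[of G i "2 ^ a"] by simp
    next
      case False
      obtain j where j: "j > 0" "(G ^^ j) (3 ^ c) = 2 ^ d"
        using funpow_G_step[OF smooth(2)] h_succ_power_3 False by (metis d_def gr0I)
      have ij: "(G ^^ (j + i)) (2 ^ a) = 2 ^ d"
        using i j by (simp add: funpow_add)
      have "(3 ^ c :: nat) \<le> 5 * 2 ^ a + 1" "(2 ^ d :: nat) \<le> 5 * 3 ^ c + 1"
        unfolding c_def d_def by (intro dvd_imp_le multiplicity_dvd; simp)+
      then have "(2 ^ d :: nat) \<le> 25 * 2 ^ a + 6" by linarith
      \<comment> \<open>This absorbs the constant: 6 < 7 * \<open>2 ^ a\<close>, so the bound stays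
        below 32 * \<open>2 ^ a\<close>.\<close>
      moreover have "(2 :: nat) ^ 1 \<le> 2 ^ a"
        using \<open>a > 0\<close> by (intro power_increasing) auto
      ultimately have "(2 ^ d :: nat) < 2 ^ (a + 5)" by (simp add: power_add)
      then have d: "d < a + 5" by simp
      consider "d mod 6 \<noteq> 4" | "d < a" | "d = a" | "d mod 6 = a mod 6" "a < d"
        using True by linarith
      then show ?thesis
      proof cases
        case 1
        then have "eventually_cyclic ((G ^^ (j + i)) (2 ^ a))"
          unfolding ij by (rule eventually_cyclic_power_2_if_not_4_mod_6)
        then show ?thesis by (rule eventually_periodic_funpowD)
      next
        case 2
        then have "eventually_cyclic ((G ^^ (j + i)) (2 ^ a))"
          unfolding ij by (rule less.IH)
        then show ?thesis by (rule eventually_periodic_funpowD)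
      next
        case 3
        \<comment> \<open>The trajectory has returned to its start, so \<open>j + i\<close> is a
          period.\<close>
        with ij have "(G ^^ (j + i)) (2 ^ a) = 2 ^ a" by simp
        then show ?thesis
          by (rule eventually_periodic_funpow_fixpoint) (use j(1) in simp)
      next
        case 4
        \<comment> \<open>A positive multiple of 6 cannot be less than 5.\<close>
        then have "6 dvd d - a" by (simp add: mod_eq_dvd_iff_nat)
        with 4(2) have "6 \<le> d - a" by (intro dvd_imp_le) simp_all
        with d show ?thesis by simp
      qed
    qed
  qed
qed

lemma eventually_cyclic_power_3: "eventually_cyclic (3 ^ b)"
proof (cases "b = 0")
  case True
  then show ?thesis using eventually_cyclic_1 by simp
next
  case False
  then show ?thesis
    using h_succ_power_3[of b] h_smooth[of 0 b] eventually_cyclic_power_2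
    by (intro eventually_cyclic_step[of "3 ^ b"]) simp_all
qed

lemma eventually_cyclic_smooth: "eventually_cyclic (2 ^ a * 3 ^ b)"
proof -
  consider "a = 0" | "b = 0" | "a > 0" "b > 0" by blast
  then show ?thesis
  proof cases
    case 3
    \<comment> \<open>Here \<open>5 * x + 1\<close> with \<open>x = 2 ^ a * 3 ^ b\<close> is coprime
      to 6, so the trajectory drops to 1.\<close>
    then have "2 dvd (5 * (2 ^ a * 3 ^ b) :: nat)" "3 dvd (5 * (2 ^ a * 3 ^ b) :: nat)"
      by simp_all
    then have "\<not> 2 dvd (5 * (2 ^ a * 3 ^ b) + 1 :: nat)" "\<not> 3 dvd (5 * (2 ^ a * 3 ^ b) + 1 :: nat)"
      by presburger+
    then have "h (5 * (2 ^ a * 3 ^ b) + 1) = 1"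
      using h_eqI[of _ 0 0] by simp
    then show ?thesis
      using eventually_cyclic_1 h_smooth by (intro eventually_cyclic_step[of "2 ^ a * 3 ^ b"]) simp_all
  qed (use eventually_cyclic_power_2 eventually_cyclic_power_3 in auto)
qed

theorem theorem4p3:
  fixes n :: nat
  assumes "n > 0"
  shows "eventually_periodic (\<lambda>k. (G ^^ k) n)"
proof (cases "n = h n")
  case True
  then show ?thesis using eventually_cyclic_smooth by (metis h_def)
next
  case False
  then have "(G ^^ 1) n = h n" by (simp add: G_def)
  then show ?thesis
    using eventually_cyclic_smooth eventually_periodic_funpowD[of G 1 n] by (simp add: h_def)
qed

end
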